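(* Let $B_0,B_\lambda\in\ell^2(K_D)$ be (exact) coefficient blocks satisfying $B_\lambda=sB_0$ with $s\in\mathbb C$, $|s|=1$. Let $e_0,e_\lambda\in\ell^2(K_D)$, and let the available (perturbed) blocks be $$\widetilde B_0=B_0+e_0,\qquad \widetilde B_\lambda=sB_0+e_\lambda.$$ Assume $$\|e_0\|\le\eta\|B_0\|,\qquad \|e_\lambda\|\le\eta\|B_0\|,\qquad 0\le\eta<1.$$ Then $\widetilde B_0\neq0$, and the block-correlation estimator $$\widehat s:=\frac{\langle\widetilde B_\lambda,\widetilde B_0\rangle}{\|\widetilde B_0\|^2}$$ satisfies $$|\widehat s-s|\le\frac{2\eta}{1-\eta}.$$
   Context: The inner product on $\ell^2(K_D)$ is linear in the first variable; all norms are $\ell^2(K_D)$-norms. $K_D=\Lambda_D^\circ/\Lambda_D$ is a finite group, where $\Lambda_D=D^{1/2}\mathbb Z^n\times D^{1/2}\mathbb Z^n$, $\Lambda_D^\circ=D^{-1/2}\mathbb Z^n\times D^{-1/2}\mathbb Z^n$ and $D=\operatorname{diag}(d_1,\dots,d_n)$ with positive integers $d_1\mid\cdots\mid d_n$. The subscript $\lambda$ denotes an element of $\Lambda_D$ labelling the translated block.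
   Formalization: The formal statement additionally assumes B_0 ≠ 0; if B_0 = 0 the bounds force e_0 = 0, so the perturbed block is 0 and the claim fails. *)

theory Defs
  imports "HOL-Analysis.Analysis" "HOL-Algebra.Coset"
begin

definition diag_pow_lattice :: "('n::finite \<Rightarrow> nat) \<Rightarrow> real \<Rightarrow> (real ^ 'n) set"
  where "diag_pow_lattice d a =
    (\<lambda>z. \<chi> i. real (d i) powr a * z $ i) ` {z. \<forall>i. z $ i \<in> \<int>}"
  \<comment> \<open>\<open>D\<^sup>a \<int>\<^sup>n\<close> for \<open>D = diag(d\<^sub>1, \<dots>, d\<^sub>n)\<close>\<close>

definition Lambda :: "('n::finite \<Rightarrow> nat) \<Rightarrow> ((real ^ 'n) \<times> (real ^ 'n)) set"
  where "Lambda d = diag_pow_lattice d (1/2) \<times> diag_pow_lattice d (1/2)"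

definition Lambda_adj :: "('n::finite \<Rightarrow> nat) \<Rightarrow> ((real ^ 'n) \<times> (real ^ 'n)) set"
  where "Lambda_adj d = diag_pow_lattice d (- 1/2) \<times> diag_pow_lattice d (- 1/2)"

definition Lambda_adj_group :: "('n::finite \<Rightarrow> nat) \<Rightarrow> ((real ^ 'n) \<times> (real ^ 'n)) monoid"
  where "Lambda_adj_group d = \<lparr>carrier = Lambda_adj d, mult = (+), one = 0\<rparr>"

definition K_group :: "('n::finite \<Rightarrow> nat) \<Rightarrow> ((real ^ 'n) \<times> (real ^ 'n)) set monoid"
  where "K_group d = Lambda_adj_group d Mod Lambda d"

abbreviation K_set :: "('n::finite \<Rightarrow> nat) \<Rightarrow> ((real ^ 'n) \<times> (real ^ 'n)) set set"
  where "K_set d \<equiv> carrier (K_group d)"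

text \<open>A function on a finite set \<open>K\<close> is represented by its extension by zero to the whole type,
  so that equality in \<open>\<ell>\<^sup>2(K)\<close> is equality of HOL functions.\<close>

definition ell2 :: "'k set \<Rightarrow> ('k \<Rightarrow> complex) set"
  where "ell2 K = {f. \<forall>k. k \<notin> K \<longrightarrow> f k = 0}"

definition ell2_inner :: "'k set \<Rightarrow> ('k \<Rightarrow> complex) \<Rightarrow> ('k \<Rightarrow> complex) \<Rightarrow> complex"
  where "ell2_inner K f g = (\<Sum>k\<in>K. f k * cnj (g k))"

definition ell2_norm :: "'k set \<Rightarrow> ('k \<Rightarrow> complex) \<Rightarrow> real"
  where "ell2_norm K f = L2_set (\<lambda>k. norm (f k)) K"

lemma ell2_inner_self: "ell2_inner K f f = complex_of_real ((ell2_norm K f)\<^sup>2)"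
  unfolding ell2_inner_def ell2_norm_def L2_set_def
  by (simp add: sum_nonneg complex_norm_square del: of_real_power)

lemma diag_pow_lattice_uminus: "x \<in> diag_pow_lattice d a \<Longrightarrow> - x \<in> diag_pow_lattice d a"
  unfolding diag_pow_lattice_def
  by (auto intro!: image_eqI[where x = "- z" for z] simp: vec_eq_iff)

lemma diag_pow_lattice_add:
  "x \<in> diag_pow_lattice d a \<Longrightarrow> y \<in> diag_pow_lattice d a \<Longrightarrow> x + y \<in> diag_pow_lattice d a"
  unfolding diag_pow_lattice_def
  by (auto intro!: image_eqI[where x = "z + w" for z w] simp: vec_eq_iff distrib_left)

lemma diag_pow_lattice_zero: "0 \<in> diag_pow_lattice d a"
  unfolding diag_pow_lattice_def
  by (auto intro!: image_eqI[where x = 0] simp: vec_eq_iff)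

lemma diag_pow_lattice_subset:
  assumes "\<And>i. d i > 0"
  shows "diag_pow_lattice d (1/2) \<subseteq> diag_pow_lattice d (- 1/2)"
proof
  fix x assume "x \<in> diag_pow_lattice d (1/2)"
  then obtain z where z: "\<forall>i. z $ i \<in> \<int>" and x: "x = (\<chi> i. real (d i) powr (1/2) * z $ i)"
    unfolding diag_pow_lattice_def by auto
  have "real (d i) powr (1/2) = real (d i) powr (- 1/2) * real (d i)" for i
    using powr_add[of "real (d i)" "- 1/2" 1] assms[of i] by simp
  then have "x = (\<chi> i. real (d i) powr (- 1/2) * (\<chi> i. real (d i) * z $ i) $ i)"
    by (simp add: x vec_eq_iff)
  moreover have "\<forall>i. (\<chi> i. real (d i) * z $ i) $ i \<in> \<int>" using z by simp
  ultimately show "x \<in> diag_pow_lattice d (- 1/2)"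
    unfolding diag_pow_lattice_def by blast
qed

lemma comm_group_Lambda_adj: "comm_group (Lambda_adj_group d)"
proof (rule comm_groupI)
  fix x assume "x \<in> carrier (Lambda_adj_group d)"
  then show "\<exists>y\<in>carrier (Lambda_adj_group d). y \<otimes>\<^bsub>Lambda_adj_group d\<^esub> x = \<one>\<^bsub>Lambda_adj_group d\<^esub>"
    by (intro bexI[of _ "- x"])
       (auto simp: Lambda_adj_group_def Lambda_adj_def diag_pow_lattice_uminus)
qed (auto simp: Lambda_adj_group_def Lambda_adj_def diag_pow_lattice_add diag_pow_lattice_zero
      zero_prod_def algebra_simps)

lemma Lambda_normal:
  assumes "\<And>i. d i > 0"
  shows "Lambda d \<lhd> Lambda_adj_group d"
proof -
  interpret comm_group "Lambda_adj_group d" by (rule comm_group_Lambda_adj)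
  have inv: "inv\<^bsub>Lambda_adj_group d\<^esub> x = - x" if "x \<in> Lambda_adj d" for x
    using that by (intro inv_equality)
      (auto simp: Lambda_adj_group_def Lambda_adj_def diag_pow_lattice_uminus)
  have sub: "Lambda d \<subseteq> Lambda_adj d"
    using diag_pow_lattice_subset[of d] assms unfolding Lambda_def Lambda_adj_def by blast
  have "subgroup (Lambda d) (Lambda_adj_group d)"
  proof (rule subgroupI)
    show "Lambda d \<subseteq> carrier (Lambda_adj_group d)" using sub by (simp add: Lambda_adj_group_def)
    show "Lambda d \<noteq> {}" using diag_pow_lattice_zero unfolding Lambda_def by blast
  next
    fix a assume "a \<in> Lambda d"
    then show "inv\<^bsub>Lambda_adj_group d\<^esub> a \<in> Lambda d"
      using inv[of a] sub by (auto simp: Lambda_def diag_pow_lattice_uminus)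
  next
    fix a b assume "a \<in> Lambda d" "b \<in> Lambda d"
    then show "a \<otimes>\<^bsub>Lambda_adj_group d\<^esub> b \<in> Lambda d"
      by (auto simp: Lambda_adj_group_def Lambda_def diag_pow_lattice_add)
  qed
  then show ?thesis by (rule subgroup_imp_normal)
qed

lemma group_K_group: "(\<And>i. d i > 0) \<Longrightarrow> group (K_group d)"
  unfolding K_group_def by (intro normal.factorgroup_is_group Lambda_normal)

lemma diag_pow_lattice_reduce:
  fixes d :: "'n::finite \<Rightarrow> nat"
  assumes pos: "\<And>i. d i > 0" and x: "x \<in> diag_pow_lattice d (- 1/2)"
  obtains u where "u \<in> (\<lambda>p. \<chi> i. real (d i) powr (- 1/2) * real (p i)) ` (\<Pi>\<^sub>E i\<in>UNIV. {..<d i})"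
    and "x - u \<in> diag_pow_lattice d (1/2)"
proof -
  obtain z where z: "\<forall>i. z $ i \<in> \<int>" and x: "x = (\<chi> i. real (d i) powr (- 1/2) * z $ i)"
    using x unfolding diag_pow_lattice_def by auto
  define p where "p i = nat (\<lfloor>z $ i\<rfloor> mod int (d i))" for i
  define q where "q = (\<chi> i. real_of_int (\<lfloor>z $ i\<rfloor> div int (d i)))"
  have zi: "z $ i = real (d i) * q $ i + real (p i)" for i
  proof -
    have "z $ i = real_of_int \<lfloor>z $ i\<rfloor>" using z by (metis Ints_cases floor_of_int)
    also have "\<dots> = real_of_int (int (d i) * (\<lfloor>z $ i\<rfloor> div int (d i))) + real_of_int (\<lfloor>z $ i\<rfloor> mod int (d i))"
      by (simp only: of_int_add [symmetric] mult_div_mod_eq)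
    also have "\<dots> = real (d i) * q $ i + real (p i)"
      using pos[of i] by (simp add: q_def p_def)
    finally show ?thesis .
  qed
  have h: "real (d i) powr (1/2) = real (d i) powr (- 1/2) * real (d i)" for i
    using powr_add[of "real (d i)" "- 1/2" 1] pos[of i] by simp
  let ?u = "\<chi> i. real (d i) powr (- 1/2) * real (p i)"
  have "x - ?u = (\<chi> i. real (d i) powr (1/2) * q $ i)"
    by (simp add: x vec_eq_iff zi h algebra_simps)
  moreover have "\<forall>i. q $ i \<in> \<int>" by (simp add: q_def)
  ultimately have "x - ?u \<in> diag_pow_lattice d (1/2)"
    unfolding diag_pow_lattice_def by blast
  moreover have "p \<in> (\<Pi>\<^sub>E i\<in>UNIV. {..<d i})"
    using pos by (auto simp: p_def nat_less_iff)
  ultimately show ?thesis by (intro that[of ?u]) auto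
qed

lemma finite_K_set:
  fixes d :: "'n::finite \<Rightarrow> nat"
  assumes pos: "\<And>i. d i > 0"
  shows "finite (K_set d)"
proof -
  interpret normal "Lambda d" "Lambda_adj_group d" using pos by (rule Lambda_normal)
  let ?F = "(\<lambda>p. \<chi> i. real (d i) powr (- 1/2) * real (p i)) ` (\<Pi>\<^sub>E i\<in>(UNIV::'n set). {..<d i})"
  have fin: "finite ?F" by (intro finite_imageI finite_PiE) auto
  have "K_set d \<subseteq> (\<lambda>u. Lambda d #>\<^bsub>Lambda_adj_group d\<^esub> u) ` (?F \<times> ?F)"
  proof
    fix c assume "c \<in> K_set d"
    then obtain x y where xy: "x \<in> diag_pow_lattice d (- 1/2)" "y \<in> diag_pow_lattice d (- 1/2)"
      and c: "c = Lambda d #>\<^bsub>Lambda_adj_group d\<^esub> (x, y)"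
      by (auto simp: K_group_def FactGroup_def RCOSETS_def Lambda_adj_group_def Lambda_adj_def)
    obtain u where u: "u \<in> ?F" "x - u \<in> diag_pow_lattice d (1/2)"
      using diag_pow_lattice_reduce[of d x] pos xy by blast
    obtain v where v: "v \<in> ?F" "y - v \<in> diag_pow_lattice d (1/2)"
      using diag_pow_lattice_reduce[of d y] pos xy by blast
    have l: "l + (x - u, y - v) \<in> Lambda d" "l - (x - u, y - v) \<in> Lambda d" if "l \<in> Lambda d" for l
      using that u(2) v(2) diag_pow_lattice_add[of "fst l" d "1/2" "x - u"]
        diag_pow_lattice_add[of "snd l" d "1/2" "y - v"]
        diag_pow_lattice_add[OF _ diag_pow_lattice_uminus, of "fst l" d "1/2" "x - u"]
        diag_pow_lattice_add[OF _ diag_pow_lattice_uminus, of "snd l" d "1/2" "y - v"]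
      by (auto simp: Lambda_def mem_Times_iff algebra_simps)
    have "c = Lambda d #>\<^bsub>Lambda_adj_group d\<^esub> (u, v)"
    proof (intro equalityI subsetI)
      fix w assume "w \<in> c"
      then obtain l where "l \<in> Lambda d" "w = l + (x, y)"
        by (auto simp: c r_coset_def Lambda_adj_group_def)
      moreover have "w = (l + (x - u, y - v)) + (u, v)" using calculation by (simp add: prod_eq_iff)
      ultimately show "w \<in> Lambda d #>\<^bsub>Lambda_adj_group d\<^esub> (u, v)"
        using l(1)[of l] by (auto simp: r_coset_def Lambda_adj_group_def)
    next
      fix w assume "w \<in> Lambda d #>\<^bsub>Lambda_adj_group d\<^esub> (u, v)"
      then obtain l where "l \<in> Lambda d" "w = l + (u, v)"
        by (auto simp: r_coset_def Lambda_adj_group_def)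
      moreover have "w = (l - (x - u, y - v)) + (x, y)" using calculation by (simp add: prod_eq_iff)
      ultimately show "w \<in> c"
        using l(2)[of l] by (auto simp: c r_coset_def Lambda_adj_group_def)
    qed
    then show "c \<in> (\<lambda>u. Lambda d #>\<^bsub>Lambda_adj_group d\<^esub> u) ` (?F \<times> ?F)" using u v by blast
  qed
  then show ?thesis by (rule finite_subset) (use fin in simp)
qed

end

theory Submission
  imports Defs
begin

text \<open>The error of the estimator is \<open>\<langle>r, Bt0\<rangle> / \<parallel>Bt0\<parallel>\<^sup>2\<close> with residual
  \<open>r = Btl - s Bt0 = el - s e0\<close>, in which \<open>B0\<close> cancels. By Cauchy-Schwarz it is at most
  \<open>\<parallel>r\<parallel> / \<parallel>Bt0\<parallel>\<close>, where \<open>\<parallel>r\<parallel> \<le> 2 \<eta> \<parallel>B0\<parallel>\<close> and \<open>\<parallel>Bt0\<parallel> \<ge> (1 - \<eta>) \<parallel>B0\<parallel>\<close>.\<close>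

lemma ell2_norm_nonneg [simp]: "0 \<le> ell2_norm K f"
  by (simp add: ell2_norm_def)

lemma ell2_norm_zero [simp]: "ell2_norm K (\<lambda>k. 0) = 0"
  by (simp add: ell2_norm_def L2_set_def)

text \<open>Since \<open>f\<close> vanishes off \<open>K\<close>, a point where it is nonzero lies
  in \<open>K\<close> and contributes to the sum; finiteness of \<open>K\<close> rules out the
  default value 0 of an infinite sum.\<close>

lemma ell2_norm_pos:
  assumes "finite K" "f \<in> ell2 K" "f \<noteq> (\<lambda>k. 0)"
  shows "0 < ell2_norm K f"
proof -
  obtain k where "f k \<noteq> 0" using assms(3) by auto
  moreover have "k \<in> K" using \<open>f k \<noteq> 0\<close> assms(2) by (auto simp: ell2_def)
  ultimately have "ell2_norm K f \<noteq> 0"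
    using assms(1) by (auto simp: ell2_norm_def L2_set_eq_0_iff)
  then show ?thesis
    using ell2_norm_nonneg[of K f] by linarith
qed

lemma ell2_norm_scale: "ell2_norm K (\<lambda>k. c * f k) = norm c * ell2_norm K f"
  by (simp add: ell2_norm_def norm_mult L2_set_right_distrib)

lemma ell2_norm_diff_le: "ell2_norm K (\<lambda>k. f k - g k) \<le> ell2_norm K f + ell2_norm K g"
proof -
  have "ell2_norm K (\<lambda>k. f k - g k) \<le> L2_set (\<lambda>k. norm (f k) + norm (g k)) K"
    unfolding ell2_norm_def by (intro L2_set_mono norm_triangle_ineq4 norm_ge_zero)
  also have "\<dots> \<le> ell2_norm K f + ell2_norm K g"
    unfolding ell2_norm_def by (rule L2_set_triangle_ineq)
  finally show ?thesis .
qed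

text \<open>The triangle inequality for the sum removes the conjugation and reduces the claim to the
  real Cauchy-Schwarz inequality for the moduli.\<close>

lemma norm_ell2_inner_le: "norm (ell2_inner K f g) \<le> ell2_norm K f * ell2_norm K g"
proof -
  have "norm (ell2_inner K f g) \<le> (\<Sum>k\<in>K. \<bar>norm (f k)\<bar> * \<bar>norm (g k)\<bar>)"
    unfolding ell2_inner_def by (rule order.trans[OF norm_sum]) (simp add: norm_mult)
  also have "\<dots> \<le> ell2_norm K f * ell2_norm K g"
    unfolding ell2_norm_def by (rule L2_set_mult_ineq)
  finally show ?thesis .
qed

lemma ell2_inner_diff_scale_left:
  "ell2_inner K (\<lambda>k. f k - c * g k) h = ell2_inner K f h - c * ell2_inner K g h"
  by (simp add: ell2_inner_def sum_subtractf sum_distrib_left algebra_simps)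

theorem proposition7p4:
  fixes d :: "'n::{finite,linorder} \<Rightarrow> nat"
    and B0 Bl e0 el Bt0 Btl :: "((real ^ 'n::{finite,linorder}) \<times> (real ^ 'n::{finite,linorder})) set \<Rightarrow> complex"
    and s :: complex and \<eta> :: real
  assumes d_pos: "\<And>i. d i > 0"
    and d_dvd: "\<And>i j. i \<le> j \<Longrightarrow> d i dvd d j"
    and B0: "B0 \<in> ell2 (K_set d)" and Bl: "Bl \<in> ell2 (K_set d)"
    and B0_nonzero: "B0 \<noteq> (\<lambda>k. 0)"
    and Bl_eq: "Bl = (\<lambda>k. s * B0 k)" and s: "norm s = 1"
    and e0: "e0 \<in> ell2 (K_set d)" and el: "el \<in> ell2 (K_set d)"
    and Bt0: "Bt0 = (\<lambda>k. B0 k + e0 k)"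
    and Btl: "Btl = (\<lambda>k. s * B0 k + el k)"
    and e0_le: "ell2_norm (K_set d) e0 \<le> \<eta> * ell2_norm (K_set d) B0"
    and el_le: "ell2_norm (K_set d) el \<le> \<eta> * ell2_norm (K_set d) B0"
    and \<eta>: "0 \<le> \<eta>" "\<eta> < 1"
  shows "Bt0 \<noteq> (\<lambda>k. 0) \<and>
    norm (ell2_inner (K_set d) Btl Bt0 / complex_of_real ((ell2_norm (K_set d) Bt0)\<^sup>2) - s)
      \<le> 2 * \<eta> / (1 - \<eta>)"
proof -
  let ?K = "K_set d"
  let ?N = "ell2_norm ?K B0" and ?M = "ell2_norm ?K Bt0"
  define r where "r = (\<lambda>k. Btl k - s * Bt0 k)"
  have N_pos: "0 < ?N"
    using finite_K_set[OF d_pos] B0 B0_nonzero by (rule ell2_norm_pos)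
  \<comment> \<open>Triangle inequality for \<open>B0 = Bt0 - e0\<close>.\<close>
  have "?N \<le> ?M + ell2_norm ?K e0"
    using ell2_norm_diff_le[of ?K Bt0 e0] by (simp add: Bt0)
  then have M_ge: "(1 - \<eta>) * ?N \<le> ?M"
    using e0_le by (simp add: algebra_simps)
  moreover have lower_pos: "0 < (1 - \<eta>) * ?N"
    using N_pos \<eta> by simp
  ultimately have M_pos: "0 < ?M"
    by linarith
  have "r = (\<lambda>k. el k - s * e0 k)"
    by (simp add: r_def Bt0 Btl algebra_simps)
  \<comment> \<open>As \<open>s\<close> has modulus 1, \<open>el\<close> and \<open>s * e0\<close>
    each contribute at most \<open>\<eta> * ?N\<close>.\<close>
  then have r_le: "ell2_norm ?K r \<le> 2 * \<eta> * ?N"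
    using ell2_norm_diff_le[of ?K el "\<lambda>k. s * e0 k"] e0_le el_le s
    by (simp add: ell2_norm_scale)
  \<comment> \<open>The inner product of \<open>s * Bt0\<close> with \<open>Bt0\<close> is
    \<open>s * ?M\<^sup>2\<close>, so dividing by \<open>?M\<^sup>2\<close> gives exactly the
    subtracted \<open>s\<close>.\<close>
  have "ell2_inner ?K Btl Bt0 / complex_of_real (?M\<^sup>2) - s
      = ell2_inner ?K r Bt0 / complex_of_real (?M\<^sup>2)"
    using M_pos by (simp add: r_def ell2_inner_diff_scale_left ell2_inner_self diff_divide_distrib)
  then have "norm (ell2_inner ?K Btl Bt0 / complex_of_real (?M\<^sup>2) - s)
      = norm (ell2_inner ?K r Bt0) / ?M\<^sup>2"
    by (simp add: norm_divide norm_power)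
  also have "\<dots> \<le> ell2_norm ?K r * ?M / ?M\<^sup>2"
    by (intro divide_right_mono norm_ell2_inner_le) simp
  also have "\<dots> = ell2_norm ?K r / ?M"
    by (simp add: power2_eq_square)
  also have "\<dots> \<le> (2 * \<eta> * ?N) / ((1 - \<eta>) * ?N)"
    using r_le M_ge lower_pos \<eta> by (intro frac_le) auto
  also have "\<dots> = 2 * \<eta> / (1 - \<eta>)"
    using N_pos by simp
  \<comment> \<open>\<open>Bt0\<close> is nonzero because the zero function has norm 0.\<close>
  finally show ?thesis
    using M_pos by auto
qed

end
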